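(* For any Markov policy $g:\mathcal X\to\{0,1\}$, \[\mathsf D^{(g)}=\frac{\mathsf L^{(g)}}{\mathsf M^{(g)}}\qquad\text{and}\qquad \mathsf N^{(g)}=\frac{1}{\beta\,\mathsf M^{(g)}}-\frac{1-\beta}{\beta}.\]
   Context: A restless bandit with controlled restarts has a finite or countable state space $\mathcal X$, actions $\{0,1\}$ (0 = passive, 1 = active), passive transition matrix $P$ (with entries $P_{xy}$), and active transitions that do not depend on the current state: under the active action the next state is drawn from a fixed distribution $Q=(Q_y)_{y\in\mathcal X}$. The cost function is $c:\mathcal X\times\{0,1\}\to\mathbb R$ and $\beta\in(0,1)$ is the discount factor. For a Markov policy $g$ (controlled process $X_{t+1}$ drawn from $P_{X_t\,\cdot}$ if $g(X_t)=0$ and from $Q$ if $g(X_t)=1$), $D^{(g)}(x)=(1-\beta)\mathbb E[\sum_{t\ge0}\beta^tc(X_t,g(X_t))\mid X_0=x]$ and $N^{(g)}(x)=(1-\beta)\mathbb E[\sum_{t\ge0}\beta^tg(X_t)\mid X_0=x]$; define $\mathsf D^{(g)}=\sum_xQ_xD^{(g)}(x)$ and $\mathsf N^{(g)}=\sum_xQ_xN^{(g)}(x)$. Let $\tau_g$ be the hitting time (first time $t\ge0$) of the set $\{x\in\mathcal X: g(x)=1\}$ by the process controlled by $g$, and define $\mathsf L^{(g)}=\mathbb E[\sum_{t=0}^{\tau_g}\beta^tc(X_t,g(X_t))\mid X_0\sim Q]$ and $\mathsf M^{(g)}=\mathbb E[\sum_{t=0}^{\tau_g}\beta^t\mid X_0\sim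 Q]$. *)

theory Defs
  imports "HOL-Probability.Probability"
begin

text \<open>Actions: False = passive (0), True = active (1).
  Passive transitions: row P x (a pmf); active transitions: fixed pmf Q.\<close>

definition ctrl_kernel :: "('x \<Rightarrow> 'x pmf) \<Rightarrow> 'x pmf \<Rightarrow> ('x \<Rightarrow> bool) \<Rightarrow> 'x \<Rightarrow> 'x pmf" where
  "ctrl_kernel P Q g x = (if g x then Q else P x)"

fun path_law :: "('x \<Rightarrow> 'x pmf) \<Rightarrow> 'x pmf \<Rightarrow> nat \<Rightarrow> 'x list pmf" where
  "path_law K mu 0 = map_pmf (\<lambda>x. [x]) mu"
| "path_law K mu (Suc n) =
     bind_pmf (path_law K mu n) (\<lambda>xs. map_pmf (\<lambda>y. xs @ [y]) (K (last xs)))"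

definition hit_time :: "('x \<Rightarrow> bool) \<Rightarrow> 'x list \<Rightarrow> enat" where
  "hit_time g xs = (if \<exists>t<length xs. g (xs ! t)
                    then enat (LEAST t. t < length xs \<and> g (xs ! t)) else \<infinity>)"

text \<open>Expectations of infinite sums are expressed as limits of expectations of
  partial sums over horizon T (the partial sum only depends on (X_0..X_T)).\<close>

definition D_pol :: "('x \<Rightarrow> 'x pmf) \<Rightarrow> 'x pmf \<Rightarrow> ('x \<Rightarrow> bool \<Rightarrow> real) \<Rightarrow> real
     \<Rightarrow> ('x \<Rightarrow> bool) \<Rightarrow> 'x \<Rightarrow> real" where
  "D_pol P Q c \<beta> g x = lim (\<lambda>T. measure_pmf.expectation
      (path_law (ctrl_kernel P Q g) (return_pmf x) T)
      (\<lambda>xs. (1 - \<beta>) * (\<Sum>t\<le>T. \<beta> ^ t * c (xs ! t) (g (xs ! t)))))"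

definition N_pol :: "('x \<Rightarrow> 'x pmf) \<Rightarrow> 'x pmf \<Rightarrow> real
     \<Rightarrow> ('x \<Rightarrow> bool) \<Rightarrow> 'x \<Rightarrow> real" where
  "N_pol P Q \<beta> g x = lim (\<lambda>T. measure_pmf.expectation
      (path_law (ctrl_kernel P Q g) (return_pmf x) T)
      (\<lambda>xs. (1 - \<beta>) * (\<Sum>t\<le>T. \<beta> ^ t * of_bool (g (xs ! t)))))"

definition D_sf :: "('x \<Rightarrow> 'x pmf) \<Rightarrow> 'x pmf \<Rightarrow> ('x \<Rightarrow> bool \<Rightarrow> real) \<Rightarrow> real
     \<Rightarrow> ('x \<Rightarrow> bool) \<Rightarrow> real" where
  "D_sf P Q c \<beta> g = measure_pmf.expectation Q (D_pol P Q c \<beta> g)"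

definition N_sf :: "('x \<Rightarrow> 'x pmf) \<Rightarrow> 'x pmf \<Rightarrow> real \<Rightarrow> ('x \<Rightarrow> bool) \<Rightarrow> real" where
  "N_sf P Q \<beta> g = measure_pmf.expectation Q (N_pol P Q \<beta> g)"

definition L_sf :: "('x \<Rightarrow> 'x pmf) \<Rightarrow> 'x pmf \<Rightarrow> ('x \<Rightarrow> bool \<Rightarrow> real) \<Rightarrow> real
     \<Rightarrow> ('x \<Rightarrow> bool) \<Rightarrow> real" where
  "L_sf P Q c \<beta> g = lim (\<lambda>T. measure_pmf.expectation
      (path_law (ctrl_kernel P Q g) Q T)
      (\<lambda>xs. \<Sum>t\<in>{t. t \<le> T \<and> enat t \<le> hit_time g xs}. \<beta> ^ t * c (xs ! t) (g (xs ! t))))"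

definition M_sf :: "('x \<Rightarrow> 'x pmf) \<Rightarrow> 'x pmf \<Rightarrow> real \<Rightarrow> ('x \<Rightarrow> bool) \<Rightarrow> real" where
  "M_sf P Q \<beta> g = lim (\<lambda>T. measure_pmf.expectation
      (path_law (ctrl_kernel P Q g) Q T)
      (\<lambda>xs. \<Sum>t\<in>{t. t \<le> T \<and> enat t \<le> hit_time g xs}. \<beta> ^ t))"

end

theory Submission
  imports Defs
begin

(*
  For a bounded reward h and weights |a| <= 1, the equation
  f x = h x + beta * a x * E_(k x) f has a unique bounded solution, its right-hand side
  being a beta-contraction of f.  With a = 1 and the controlled kernel it is the value V_h of
  the policy; with a the indicator of the passive states the chain is killed after the
  hitting time tau of the active set, giving the stopped value S_h, whose Q-average is L
  (and M for h = 1).  At an active state the chain restarts from Q, so V_h also solves the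
  stopped equation with the extra reward beta * E_Q V_h at active states:
  V_h = S_h + beta * E_Q V_h * S_g, where S_g = E beta^tau.  Moreover
  (1 - beta) * S_1 + beta * S_g = 1, which is E (1 - beta^(tau+1)) + E beta^(tau+1) = 1.
  Averaging over Q gives (1 - beta) * M * E_Q V_h = L, i.e. D = L / M; and as N is D for the
  cost g, N = E_Q S_g / M = (1 - (1 - beta) * M) / (beta * M).
*)

lemma measure_pmf_integrable_bounded:
  fixes f :: "'a \<Rightarrow> real"
  assumes "\<And>y. \<bar>f y\<bar> \<le> B"
  shows "integrable (measure_pmf p) f"
  by (rule measure_pmf.integrable_const_bound[where B=B]) (use assms in auto)

lemma measure_pmf_abs_expectation_le:
  fixes f :: "'a \<Rightarrow> real"
  assumes "\<And>y. \<bar>f y\<bar> \<le> B"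
  shows "\<bar>measure_pmf.expectation p f\<bar> \<le> B"
proof -
  have "\<bar>measure_pmf.expectation p f\<bar> \<le> measure_pmf.expectation p (\<lambda>y. \<bar>f y\<bar>)"
    by (rule integral_abs_bound)
  also have "\<dots> \<le> B"
    using assms by (intro measure_pmf.integral_le_const measure_pmf_integrable_bounded[where B=B]) auto
  finally show ?thesis .
qed

lemma expectation_bind_pmf:
  fixes f :: "'b \<Rightarrow> real"
  assumes "\<And>y. \<bar>f y\<bar> \<le> B"
  shows "measure_pmf.expectation (bind_pmf M N) f =
    measure_pmf.expectation M (\<lambda>x. measure_pmf.expectation (N x) f)"
  using measurable_measure_pmf[of N] assms
  unfolding measure_pmf_bind
  by (subst integral_bind[where K="count_space UNIV" and B=B and B'=1])
     (auto intro!: measure_pmf.finite_measure)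

section \<open>Discounted values of bounded rewards\<close>

primrec value_iter ::
    "real \<Rightarrow> ('x \<Rightarrow> real) \<Rightarrow> ('x \<Rightarrow> real) \<Rightarrow> ('x \<Rightarrow> 'x pmf) \<Rightarrow> nat \<Rightarrow> 'x \<Rightarrow> real" where
  "value_iter \<beta> h a k 0 x = h x"
| "value_iter \<beta> h a k (Suc n) x =
     h x + \<beta> * a x * measure_pmf.expectation (k x) (value_iter \<beta> h a k n)"

definition discounted_value ::
    "real \<Rightarrow> ('x \<Rightarrow> real) \<Rightarrow> ('x \<Rightarrow> real) \<Rightarrow> ('x \<Rightarrow> 'x pmf) \<Rightarrow> 'x \<Rightarrow> real" where
  "discounted_value \<beta> h a k x = lim (\<lambda>n. value_iter \<beta> h a k n x)"

lemma abs_discounted_step_le: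
  fixes \<beta> e :: real
  assumes "0 \<le> \<beta>" and "\<bar>a\<bar> \<le> 1" and "\<bar>e\<bar> \<le> C"
  shows "\<bar>\<beta> * a * e\<bar> \<le> \<beta> * C"
proof -
  have "\<bar>\<beta> * a * e\<bar> = \<beta> * (\<bar>a\<bar> * \<bar>e\<bar>)"
    using assms(1) by (simp add: abs_mult)
  also have "\<dots> \<le> \<beta> * (1 * C)"
    using assms by (intro mult_left_mono mult_mono) auto
  finally show ?thesis by simp
qed

context
  fixes \<beta> :: real and h a :: "'x \<Rightarrow> real" and k :: "'x \<Rightarrow> 'x pmf" and B :: real
  assumes \<beta>_nonneg: "0 \<le> \<beta>" and \<beta>_less_1: "\<beta> < 1"
    and h_bounded: "\<And>x. \<bar>h x\<bar> \<le> B" and a_bounded: "\<And>x. \<bar>a x\<bar> \<le> 1"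
begin

lemma abs_value_iter_le: "\<bar>value_iter \<beta> h a k n x\<bar> \<le> B / (1 - \<beta>)"
proof (induction n arbitrary: x)
  case 0
  have "0 \<le> B" using h_bounded[of x] by simp
  then have "B \<le> B / (1 - \<beta>)"
    using \<beta>_nonneg \<beta>_less_1 by (simp add: field_simps mult_left_le)
  then show ?case using h_bounded[of x] by simp
next
  case (Suc n)
  have "\<bar>\<beta> * a x * measure_pmf.expectation (k x) (value_iter \<beta> h a k n)\<bar> \<le> \<beta> * (B / (1 - \<beta>))"
    using Suc.IH
    by (intro abs_discounted_step_le \<beta>_nonneg a_bounded measure_pmf_abs_expectation_le)
  moreover have "B + \<beta> * (B / (1 - \<beta>)) = B / (1 - \<beta>)"
    using \<beta>_less_1 by (simp add: field_simps)
  ultimately show ?case using h_bounded[of x] by simp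
qed

lemma integrable_value_iter: "integrable (measure_pmf p) (value_iter \<beta> h a k n)"
  by (rule measure_pmf_integrable_bounded) (rule abs_value_iter_le)

lemma abs_value_iter_Suc_diff_le:
  "\<bar>value_iter \<beta> h a k (Suc n) x - value_iter \<beta> h a k n x\<bar> \<le> B * \<beta> ^ Suc n"
proof (induction n arbitrary: x)
  case 0
  have "\<bar>\<beta> * a x * measure_pmf.expectation (k x) h\<bar> \<le> \<beta> * B"
    by (intro abs_discounted_step_le \<beta>_nonneg a_bounded measure_pmf_abs_expectation_le h_bounded)
  moreover have "value_iter \<beta> h a k 0 = h" by (rule ext) simp
  ultimately show ?case by (simp add: mult.commute)
next
  case (Suc n)
  let ?d = "\<lambda>y. value_iter \<beta> h a k (Suc n) y - value_iter \<beta> h a k n y"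
  have "value_iter \<beta> h a k (Suc (Suc n)) x - value_iter \<beta> h a k (Suc n) x =
      \<beta> * a x * (measure_pmf.expectation (k x) (value_iter \<beta> h a k (Suc n))
        - measure_pmf.expectation (k x) (value_iter \<beta> h a k n))"
    by (simp only: value_iter.simps(2)) (simp add: algebra_simps)
  also have "\<dots> = \<beta> * a x * measure_pmf.expectation (k x) ?d"
    by (subst Bochner_Integration.integral_diff[OF integrable_value_iter integrable_value_iter]) (rule refl)
  also have "\<bar>\<dots>\<bar> \<le> \<beta> * (B * \<beta> ^ Suc n)"
    using Suc.IH
    by (intro abs_discounted_step_le \<beta>_nonneg a_bounded measure_pmf_abs_expectation_le)
  finally show ?case by (simp add: algebra_simps)
qed

lemma value_iter_tendsto: "(\<lambda>n. value_iter \<beta> h a k n x) \<longlonglongrightarrow> discounted_value \<beta> h a k x"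
proof -
  define d where "d n = value_iter \<beta> h a k (Suc n) x - value_iter \<beta> h a k n x" for n
  have "summable (\<lambda>n. B * \<beta> ^ Suc n)"
    using \<beta>_nonneg \<beta>_less_1 by (intro summable_mult summable_geometric_iff[THEN iffD2] summable_mult2) auto
  moreover have "norm (d n) \<le> B * \<beta> ^ Suc n" for n
    unfolding d_def real_norm_def by (rule abs_value_iter_Suc_diff_le)
  ultimately have "summable d"
    by (blast intro: summable_comparison_test')
  then have "(\<lambda>n. h x + (\<Sum>i<n. d i)) \<longlonglongrightarrow> h x + suminf d"
    by (intro tendsto_add tendsto_const summable_LIMSEQ)
  moreover have "h x + (\<Sum>i<n. d i) = value_iter \<beta> h a k n x" for n
    unfolding d_def by (subst sum_lessThan_telescope) simp
  ultimately have "convergent (\<lambda>n. value_iter \<beta> h a k n x)"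
    unfolding convergent_def by auto
  then show ?thesis
    unfolding discounted_value_def by (simp add: convergent_LIMSEQ_iff)
qed

lemma abs_discounted_value_le: "\<bar>discounted_value \<beta> h a k x\<bar> \<le> B / (1 - \<beta>)"
  by (rule LIMSEQ_le_const2[OF tendsto_rabs[OF value_iter_tendsto]])
     (auto intro: abs_value_iter_le)

lemma integrable_discounted_value: "integrable (measure_pmf p) (discounted_value \<beta> h a k)"
  by (rule measure_pmf_integrable_bounded) (rule abs_discounted_value_le)

lemma expectation_value_iter_tendsto:
  "(\<lambda>n. measure_pmf.expectation p (value_iter \<beta> h a k n))
     \<longlonglongrightarrow> measure_pmf.expectation p (discounted_value \<beta> h a k)"
  by (rule integral_dominated_convergence[where w="\<lambda>_. B / (1 - \<beta>)"])
     (auto intro: value_iter_tendsto abs_value_iter_le)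

lemma discounted_value_bellman:
  "discounted_value \<beta> h a k x =
     h x + \<beta> * a x * measure_pmf.expectation (k x) (discounted_value \<beta> h a k)"
proof -
  have "(\<lambda>n. value_iter \<beta> h a k (Suc n) x)
      \<longlonglongrightarrow> h x + \<beta> * a x * measure_pmf.expectation (k x) (discounted_value \<beta> h a k)"
    unfolding value_iter.simps by (intro tendsto_intros expectation_value_iter_tendsto)
  then show ?thesis
    using LIMSEQ_unique[OF LIMSEQ_Suc[OF value_iter_tendsto]] by blast
qed

end

lemma homogeneous_bellman_solution_eq_0:
  fixes f :: "'x \<Rightarrow> real"
  assumes "0 \<le> \<beta>" and "\<beta> < 1" and a_bounded: "\<And>x. \<bar>a x\<bar> \<le> 1"
    and f_bounded: "\<And>x. \<bar>f x\<bar> \<le> C"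
    and f_eq: "\<And>x. f x = \<beta> * a x * measure_pmf.expectation (k x) f"
  shows "f = (\<lambda>_. 0)"
proof
  fix x
  have f_le: "\<bar>f y\<bar> \<le> \<beta> ^ n * C" for n y
  proof (induction n arbitrary: y)
    case 0
    then show ?case using f_bounded by simp
  next
    case (Suc n)
    have "\<bar>\<beta> * a y * measure_pmf.expectation (k y) f\<bar> \<le> \<beta> * (\<beta> ^ n * C)"
      using Suc.IH by (intro abs_discounted_step_le assms(1) a_bounded measure_pmf_abs_expectation_le)
    then show ?case using f_eq[of y] by simp
  qed
  have "(\<lambda>n. \<beta> ^ n * C) \<longlonglongrightarrow> 0"
    using assms(1,2) by (intro tendsto_mult_left_zero LIMSEQ_power_zero) auto
  then have "\<bar>f x\<bar> \<le> 0"
    by (rule LIMSEQ_le_const) (auto intro: f_le)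
  then show "f x = 0" by simp
qed

lemma discounted_value_unique:
  fixes f :: "'x \<Rightarrow> real"
  assumes \<beta>: "0 \<le> \<beta>" "\<beta> < 1" and h_bounded: "\<And>x. \<bar>h x\<bar> \<le> B"
    and a_bounded: "\<And>x. \<bar>a x\<bar> \<le> 1" and f_bounded: "\<And>x. \<bar>f x\<bar> \<le> C"
    and f_eq: "\<And>x. f x = h x + \<beta> * a x * measure_pmf.expectation (k x) f"
  shows "discounted_value \<beta> h a k = f"
proof -
  let ?V = "discounted_value \<beta> h a k"
  have "(\<lambda>x. ?V x - f x) = (\<lambda>_. 0)"
  proof (rule homogeneous_bellman_solution_eq_0[OF \<beta> a_bounded])
    have V_bounded: "\<bar>?V x\<bar> \<le> B / (1 - \<beta>)" for x
      by (rule abs_discounted_value_le[OF \<beta> h_bounded a_bounded])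
    show "\<bar>?V x - f x\<bar> \<le> B / (1 - \<beta>) + C" for x
      using V_bounded[of x] f_bounded[of x] by linarith
    have "integrable (measure_pmf p) f" for p
      by (rule measure_pmf_integrable_bounded) (rule f_bounded)
    then show "?V x - f x = \<beta> * a x * measure_pmf.expectation (k x) (\<lambda>y. ?V y - f y)" for x
      using discounted_value_bellman[OF \<beta> h_bounded a_bounded] f_eq[of x]
      by (simp add: Bochner_Integration.integral_diff integrable_discounted_value[OF \<beta> h_bounded a_bounded]
          algebra_simps)
  qed
  then show ?thesis by (simp add: fun_eq_iff)
qed

lemma abs_lincomb_le:
  fixes x y :: real
  assumes "\<bar>x\<bar> \<le> X" and "\<bar>y\<bar> \<le> Y"
  shows "\<bar>u * x + v * y\<bar> \<le> \<bar>u\<bar> * X + \<bar>v\<bar> * Y"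
  using assms by (auto simp: abs_mult intro!: abs_triangle_ineq[THEN order_trans] add_mono mult_left_mono)

lemma discounted_value_linear:
  assumes \<beta>: "0 \<le> \<beta>" "\<beta> < 1" and h1_bounded: "\<And>x. \<bar>h1 x\<bar> \<le> B"
    and h2_bounded: "\<And>x. \<bar>h2 x\<bar> \<le> C" and a_bounded: "\<And>x. \<bar>a x\<bar> \<le> 1"
  shows "discounted_value \<beta> (\<lambda>x. u * h1 x + v * h2 x) a k =
    (\<lambda>x. u * discounted_value \<beta> h1 a k x + v * discounted_value \<beta> h2 a k x)"
proof (rule discounted_value_unique[OF \<beta> _ a_bounded])
  let ?V1 = "discounted_value \<beta> h1 a k" and ?V2 = "discounted_value \<beta> h2 a k"
  have V1_bounded: "\<bar>?V1 x\<bar> \<le> B / (1 - \<beta>)" and V2_bounded: "\<bar>?V2 x\<bar> \<le> C / (1 - \<beta>)" for x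
    by (rule abs_discounted_value_le[OF \<beta> h1_bounded a_bounded]
        abs_discounted_value_le[OF \<beta> h2_bounded a_bounded])+
  show "\<bar>u * h1 x + v * h2 x\<bar> \<le> \<bar>u\<bar> * B + \<bar>v\<bar> * C" for x
    by (intro abs_lincomb_le h1_bounded h2_bounded)
  show "\<bar>u * ?V1 x + v * ?V2 x\<bar> \<le> \<bar>u\<bar> * (B / (1 - \<beta>)) + \<bar>v\<bar> * (C / (1 - \<beta>))" for x
    by (intro abs_lincomb_le V1_bounded V2_bounded)
  have bellman1: "?V1 x = h1 x + \<beta> * a x * measure_pmf.expectation (k x) ?V1"
    and bellman2: "?V2 x = h2 x + \<beta> * a x * measure_pmf.expectation (k x) ?V2" for x
    by (rule discounted_value_bellman[OF \<beta> h1_bounded a_bounded]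
        discounted_value_bellman[OF \<beta> h2_bounded a_bounded])+
  have "integrable (measure_pmf p) ?V1" and "integrable (measure_pmf p) ?V2" for p
    by (rule integrable_discounted_value[OF \<beta> h1_bounded a_bounded]
        integrable_discounted_value[OF \<beta> h2_bounded a_bounded])+
  then have expectation_lincomb: "measure_pmf.expectation p (\<lambda>y. u * ?V1 y + v * ?V2 y) =
      u * measure_pmf.expectation p ?V1 + v * measure_pmf.expectation p ?V2" for p
    by simp
  show "u * ?V1 x + v * ?V2 x = u * h1 x + v * h2 x +
      \<beta> * a x * measure_pmf.expectation (k x) (\<lambda>y. u * ?V1 y + v * ?V2 y)" for x
    unfolding expectation_lincomb using bellman1[of x] bellman2[of x] by (simp add: algebra_simps)
qed

lemma discounted_value_nonneg:
  assumes \<beta>: "0 \<le> \<beta>" "\<beta> < 1" and h_bounded: "\<And>x. \<bar>h x\<bar> \<le> B"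
    and a_bounded: "\<And>x. \<bar>a x\<bar> \<le> 1" and h_nonneg: "\<And>x. 0 \<le> h x" and a_nonneg: "\<And>x. 0 \<le> a x"
  shows "0 \<le> discounted_value \<beta> h a k x"
proof -
  have "0 \<le> value_iter \<beta> h a k n x" for n x
  proof (induction n arbitrary: x)
    case 0
    then show ?case using h_nonneg by simp
  next
    case (Suc n)
    have "0 \<le> measure_pmf.expectation (k x) (value_iter \<beta> h a k n)"
      by (rule integral_nonneg_AE) (simp add: Suc.IH)
    then show ?case using \<beta> h_nonneg[of x] a_nonneg[of x] by simp
  qed
  then show ?thesis
    by (intro LIMSEQ_le_const[OF value_iter_tendsto[OF \<beta> h_bounded a_bounded]]) auto
qed

lemma discounted_value_one_ge_1:
  assumes \<beta>: "0 \<le> \<beta>" "\<beta> < 1" and a_bounded: "\<And>x. \<bar>a x\<bar> \<le> 1" and a_nonneg: "\<And>x. 0 \<le> a x"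
  shows "1 \<le> discounted_value \<beta> (\<lambda>_. 1) a k x"
proof -
  let ?V = "discounted_value \<beta> (\<lambda>_. 1) a k"
  have "0 \<le> ?V y" for y
    by (rule discounted_value_nonneg[where B=1, OF \<beta> _ a_bounded _ a_nonneg]) simp_all
  then have "0 \<le> measure_pmf.expectation (k x) ?V"
    by (simp add: integral_nonneg_AE)
  moreover have "?V x = 1 + \<beta> * a x * measure_pmf.expectation (k x) ?V"
    by (rule discounted_value_bellman[OF \<beta> _ a_bounded, where B=1]) simp
  ultimately show ?thesis using \<beta> a_nonneg[of x] by simp
qed

lemma discounted_value_hitting_identity:
  fixes g :: "'x \<Rightarrow> bool"
  defines "a \<equiv> \<lambda>x. of_bool (\<not> g x)"
  assumes \<beta>: "0 \<le> \<beta>" "\<beta> < 1"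
  shows "(1 - \<beta>) * discounted_value \<beta> (\<lambda>_. 1) a k x
    + \<beta> * discounted_value \<beta> (\<lambda>x. of_bool (g x)) a k x = 1"
proof -
  have a_bounded: "\<bar>a x\<bar> \<le> 1" for x by (simp add: a_def)
  have "discounted_value \<beta> (\<lambda>x. (1 - \<beta>) * 1 + \<beta> * of_bool (g x)) a k = (\<lambda>_. 1)"
    by (rule discounted_value_unique[OF \<beta> _ a_bounded, where B=1 and C=1]) (use \<beta> in \<open>auto simp: a_def\<close>)
  moreover have "discounted_value \<beta> (\<lambda>x. (1 - \<beta>) * 1 + \<beta> * of_bool (g x)) a k =
      (\<lambda>x. (1 - \<beta>) * discounted_value \<beta> (\<lambda>_. 1) a k x + \<beta> * discounted_value \<beta> (\<lambda>x. of_bool (g x)) a k x)"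
    by (rule discounted_value_linear[where B=1 and C=1, OF \<beta> _ _ a_bounded]) simp_all
  ultimately show ?thesis by (metis (mono_tags))
qed

lemma policy_value_renewal:
  fixes P :: "'x \<Rightarrow> 'x pmf" and Q :: "'x pmf" and g :: "'x \<Rightarrow> bool"
  defines "K \<equiv> ctrl_kernel P Q g" and "a \<equiv> \<lambda>x. of_bool (\<not> g x)"
  assumes \<beta>: "0 \<le> \<beta>" "\<beta> < 1" and h_bounded: "\<And>x. \<bar>h x\<bar> \<le> B"
  shows "discounted_value \<beta> h (\<lambda>_. 1) K x = discounted_value \<beta> h a K x
    + \<beta> * measure_pmf.expectation Q (discounted_value \<beta> h (\<lambda>_. 1) K)
      * discounted_value \<beta> (\<lambda>x. of_bool (g x)) a K x"
proof -
  let ?V = "discounted_value \<beta> h (\<lambda>_. 1) K"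
  define r where "r = \<beta> * measure_pmf.expectation Q ?V"
  have a_bounded: "\<bar>a x\<bar> \<le> 1" for x by (simp add: a_def)
  have V_bellman: "?V x = h x + \<beta> * 1 * measure_pmf.expectation (K x) ?V" for x
    by (rule discounted_value_bellman[OF \<beta> h_bounded]) simp
  have "discounted_value \<beta> (\<lambda>x. 1 * h x + r * of_bool (g x)) a K = ?V"
  proof (rule discounted_value_unique[OF \<beta> _ a_bounded])
    show "\<bar>1 * h x + r * of_bool (g x)\<bar> \<le> \<bar>1\<bar> * B + \<bar>r\<bar> * 1" for x
      by (intro abs_lincomb_le h_bounded) simp
    show "\<bar>?V x\<bar> \<le> B / (1 - \<beta>)" for x
      by (rule abs_discounted_value_le[OF \<beta> h_bounded]) simp
    show "?V x = 1 * h x + r * of_bool (g x) + \<beta> * a x * measure_pmf.expectation (K x) ?V" for x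
      using V_bellman[of x] by (cases "g x") (simp_all add: K_def a_def ctrl_kernel_def r_def)
  qed
  moreover have "discounted_value \<beta> (\<lambda>x. 1 * h x + r * of_bool (g x)) a K =
      (\<lambda>x. 1 * discounted_value \<beta> h a K x + r * discounted_value \<beta> (\<lambda>x. of_bool (g x)) a K x)"
    by (rule discounted_value_linear[where C=1, OF \<beta> h_bounded _ a_bounded]) simp
  ultimately show ?thesis by (metis r_def mult_1)
qed

section \<open>Expectations along paths of the controlled chain\<close>

lemma length_path_law: "xs \<in> set_pmf (path_law K \<mu> n) \<Longrightarrow> length xs = Suc n"
  by (induction n arbitrary: xs) auto

lemma path_law_eq_bind_return: "path_law K \<mu> n = bind_pmf \<mu> (\<lambda>x. path_law K (return_pmf x) n)"
  by (induction n) (simp_all add: map_pmf_def bind_return_pmf bind_assoc_pmf)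

lemma path_law_Suc_return:
  "path_law K (return_pmf x) (Suc n) =
     bind_pmf (K x) (\<lambda>y. map_pmf (Cons x) (path_law K (return_pmf y) n))"
proof (induction n)
  case 0
  then show ?case
    by (simp add: map_pmf_def bind_return_pmf bind_assoc_pmf)
next
  case (Suc n)
  have "path_law K (return_pmf x) (Suc (Suc n)) =
      bind_pmf (K x) (\<lambda>y. bind_pmf (path_law K (return_pmf y) n)
        (\<lambda>ys. map_pmf (\<lambda>z. (x # ys) @ [z]) (K (last (x # ys)))))"
    unfolding path_law.simps(2)[of K _ "Suc n"] Suc
    by (simp add: bind_assoc_pmf map_pmf_def bind_return_pmf)
  also have "\<dots> = bind_pmf (K x) (\<lambda>y. bind_pmf (path_law K (return_pmf y) n)
      (\<lambda>ys. map_pmf (Cons x) (map_pmf (\<lambda>z. ys @ [z]) (K (last ys)))))"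
  proof (intro bind_pmf_cong refl)
    fix y ys
    assume "ys \<in> set_pmf (path_law K (return_pmf y) n)"
    then have "ys \<noteq> []" by (auto dest: length_path_law)
    then show "map_pmf (\<lambda>z. (x # ys) @ [z]) (K (last (x # ys))) =
        map_pmf (Cons x) (map_pmf (\<lambda>z. ys @ [z]) (K (last ys)))"
      by (simp add: pmf.map_comp o_def)
  qed
  also have "\<dots> = bind_pmf (K x) (\<lambda>y. map_pmf (Cons x) (path_law K (return_pmf y) (Suc n)))"
    by (simp add: map_bind_pmf)
  finally show ?case .
qed

definition discounted_path_sum ::
    "real \<Rightarrow> ('x \<Rightarrow> real) \<Rightarrow> ('x \<Rightarrow> real) \<Rightarrow> nat \<Rightarrow> 'x list \<Rightarrow> real" where
  "discounted_path_sum \<beta> h a n xs = (\<Sum>t\<le>n. \<beta> ^ t * (\<Prod>s<t. a (xs ! s)) * h (xs ! t))"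

lemma discounted_path_sum_Suc_Cons:
  "discounted_path_sum \<beta> h a (Suc n) (x # xs) = h x + \<beta> * a x * discounted_path_sum \<beta> h a n xs"
  unfolding discounted_path_sum_def sum.atMost_Suc_shift
  by (simp add: prod.lessThan_Suc_shift sum_distrib_left algebra_simps del: prod.lessThan_Suc)

lemma abs_discounted_path_sum_le:
  assumes "0 \<le> \<beta>" and "\<beta> \<le> 1" and h_bounded: "\<And>x. \<bar>h x\<bar> \<le> B"
    and a_bounded: "\<And>x. \<bar>a x\<bar> \<le> 1"
  shows "\<bar>discounted_path_sum \<beta> h a n xs\<bar> \<le> real (Suc n) * B"
proof -
  have "\<bar>\<beta> ^ t * (\<Prod>s<t. a (xs ! s)) * h (xs ! t)\<bar> \<le> 1 * 1 * B" for t
    unfolding abs_mult abs_prod using assms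
    by (intro mult_mono prod_le_1 prod_nonneg) (auto simp: power_le_one)
  then have "\<bar>discounted_path_sum \<beta> h a n xs\<bar> \<le> (\<Sum>t\<le>n. B)"
    unfolding discounted_path_sum_def by (intro sum_abs[THEN order_trans] sum_mono) simp
  then show ?thesis by simp
qed

lemma expectation_discounted_path_sum:
  assumes \<beta>: "0 \<le> \<beta>" "\<beta> < 1" and h_bounded: "\<And>x. \<bar>h x\<bar> \<le> B"
    and a_bounded: "\<And>x. \<bar>a x\<bar> \<le> 1"
  shows "measure_pmf.expectation (path_law k (return_pmf x) n) (discounted_path_sum \<beta> h a n)
    = value_iter \<beta> h a k n x"
proof (induction n arbitrary: x)
  case 0
  then show ?case by (simp add: discounted_path_sum_def)
next
  case (Suc n)
  have path_sum_bounded: "\<bar>discounted_path_sum \<beta> h a m xs\<bar> \<le> real (Suc m) * B" for m xs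
    using \<beta> by (intro abs_discounted_path_sum_le h_bounded a_bounded) auto
  have "measure_pmf.expectation (path_law k (return_pmf x) (Suc n)) (discounted_path_sum \<beta> h a (Suc n))
      = measure_pmf.expectation (k x) (\<lambda>y. measure_pmf.expectation (path_law k (return_pmf y) n)
          (\<lambda>ys. h x + \<beta> * a x * discounted_path_sum \<beta> h a n ys))"
    unfolding path_law_Suc_return
    by (subst expectation_bind_pmf[OF path_sum_bounded]) (simp add: discounted_path_sum_Suc_Cons)
  also have "\<dots> = measure_pmf.expectation (k x) (\<lambda>y. h x + \<beta> * a x * value_iter \<beta> h a k n y)"
  proof -
    have "integrable (measure_pmf p) (discounted_path_sum \<beta> h a n)" for p
      by (rule measure_pmf_integrable_bounded) (rule path_sum_bounded)
    then show ?thesis by (simp add: Suc.IH)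
  qed
  also have "\<dots> = value_iter \<beta> h a k (Suc n) x"
  proof -
    have "integrable (measure_pmf (k x)) (value_iter \<beta> h a k n)"
      by (rule integrable_value_iter[OF \<beta> h_bounded a_bounded])
    then show ?thesis by simp
  qed
  finally show ?case .
qed

lemma prod_of_bool_lessThan: "(\<Prod>s<(t::nat). of_bool (P s) :: 'a::comm_semiring_1) = of_bool (\<forall>s<t. P s)"
  by (induction t) (auto simp: less_Suc_eq)

lemma enat_le_hit_time_iff:
  assumes "t \<le> length xs"
  shows "enat t \<le> hit_time g xs \<longleftrightarrow> (\<forall>s<t. \<not> g (xs ! s))"
proof (cases "\<exists>s<length xs. g (xs ! s)")
  case True
  define l where "l = (LEAST s. s < length xs \<and> g (xs ! s))"
  have l: "l < length xs" "g (xs ! l)"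
    using LeastI_ex[OF True] unfolding l_def by auto
  have l_least: "l \<le> s" if "s < length xs" "g (xs ! s)" for s
    using that unfolding l_def by (auto intro: Least_le)
  have "enat t \<le> hit_time g xs \<longleftrightarrow> t \<le> l"
    using True by (simp add: hit_time_def l_def)
  also have "\<dots> \<longleftrightarrow> (\<forall>s<t. \<not> g (xs ! s))"
    using l l_least assms by (meson le_less_trans not_le order.strict_trans2)
  finally show ?thesis .
next
  case False
  then show ?thesis using assms by (auto simp: hit_time_def)
qed

lemma stopped_sum_eq_discounted_path_sum:
  assumes "length xs = Suc n"
  shows "(\<Sum>t\<in>{t. t \<le> n \<and> enat t \<le> hit_time g xs}. \<beta> ^ t * h (xs ! t))
    = discounted_path_sum \<beta> h (\<lambda>x. of_bool (\<not> g x)) n xs"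
proof -
  have "{t. t \<le> n \<and> enat t \<le> hit_time g xs} = {..n} \<inter> {t. enat t \<le> hit_time g xs}"
    by auto
  then have "(\<Sum>t\<in>{t. t \<le> n \<and> enat t \<le> hit_time g xs}. \<beta> ^ t * h (xs ! t))
      = (\<Sum>t\<le>n. \<beta> ^ t * of_bool (enat t \<le> hit_time g xs) * h (xs ! t))"
    by (simp add: sum_mult_of_bool_eq[symmetric] mult_ac)
  also have "\<dots> = discounted_path_sum \<beta> h (\<lambda>x. of_bool (\<not> g x)) n xs"
    unfolding discounted_path_sum_def prod_of_bool_lessThan
    using assms by (intro sum.cong refl) (simp add: enat_le_hit_time_iff)
  finally show ?thesis .
qed

section \<open>The cost and activation rates of a policy\<close>

lemma D_pol_eq_discounted_value:
  fixes c :: "'x \<Rightarrow> bool \<Rightarrow> real"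
  assumes \<beta>: "0 \<le> \<beta>" "\<beta> < 1" and c_bounded: "\<And>x b. \<bar>c x b\<bar> \<le> B"
  shows "D_pol P Q c \<beta> g x =
    (1 - \<beta>) * discounted_value \<beta> (\<lambda>x. c x (g x)) (\<lambda>_. 1) (ctrl_kernel P Q g) x"
proof -
  let ?h = "\<lambda>x. c x (g x)" and ?K = "ctrl_kernel P Q g"
  have path_expectation: "measure_pmf.expectation (path_law ?K (return_pmf x) T)
      (\<lambda>xs. (1 - \<beta>) * (\<Sum>t\<le>T. \<beta> ^ t * c (xs ! t) (g (xs ! t))))
      = (1 - \<beta>) * value_iter \<beta> ?h (\<lambda>_. 1) ?K T x" for T
  proof -
    have "measure_pmf.expectation (path_law ?K (return_pmf x) T)
        (\<lambda>xs. (1 - \<beta>) * (\<Sum>t\<le>T. \<beta> ^ t * c (xs ! t) (g (xs ! t))))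
        = (1 - \<beta>) * measure_pmf.expectation (path_law ?K (return_pmf x) T)
            (discounted_path_sum \<beta> ?h (\<lambda>_. 1) T)"
      by (simp add: discounted_path_sum_def[abs_def])
    also have "\<dots> = (1 - \<beta>) * value_iter \<beta> ?h (\<lambda>_. 1) ?K T x"
      by (subst expectation_discounted_path_sum[OF \<beta> c_bounded]) simp_all
    finally show ?thesis .
  qed
  show ?thesis
    unfolding D_pol_def path_expectation
    by (intro limI tendsto_mult_left value_iter_tendsto[OF \<beta> c_bounded]) simp
qed

lemma L_sf_eq_expectation_discounted_value:
  fixes c :: "'x \<Rightarrow> bool \<Rightarrow> real"
  assumes \<beta>: "0 \<le> \<beta>" "\<beta> < 1" and c_bounded: "\<And>x b. \<bar>c x b\<bar> \<le> B"
  shows "L_sf P Q c \<beta> g = measure_pmf.expectation Q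
    (discounted_value \<beta> (\<lambda>x. c x (g x)) (\<lambda>x. of_bool (\<not> g x)) (ctrl_kernel P Q g))"
proof -
  let ?h = "\<lambda>x. c x (g x)" and ?a = "\<lambda>x. of_bool (\<not> g x) :: real" and ?K = "ctrl_kernel P Q g"
  have path_sum_bounded: "\<bar>discounted_path_sum \<beta> ?h ?a T xs\<bar> \<le> real (Suc T) * B" for T xs
    using \<beta> by (intro abs_discounted_path_sum_le c_bounded) auto
  have "measure_pmf.expectation (path_law ?K Q T)
      (\<lambda>xs. \<Sum>t\<in>{t. t \<le> T \<and> enat t \<le> hit_time g xs}. \<beta> ^ t * c (xs ! t) (g (xs ! t)))
      = measure_pmf.expectation Q (value_iter \<beta> ?h ?a ?K T)" for T
  proof -
    have "measure_pmf.expectation (path_law ?K Q T)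
        (\<lambda>xs. \<Sum>t\<in>{t. t \<le> T \<and> enat t \<le> hit_time g xs}. \<beta> ^ t * c (xs ! t) (g (xs ! t)))
        = measure_pmf.expectation (path_law ?K Q T) (discounted_path_sum \<beta> ?h ?a T)"
      by (intro integral_cong_AE AE_pmfI stopped_sum_eq_discounted_path_sum length_path_law) simp_all
    also have "\<dots> = measure_pmf.expectation Q
        (\<lambda>x. measure_pmf.expectation (path_law ?K (return_pmf x) T) (discounted_path_sum \<beta> ?h ?a T))"
      unfolding path_law_eq_bind_return[of _ Q] by (rule expectation_bind_pmf) (rule path_sum_bounded)
    also have "\<dots> = measure_pmf.expectation Q (value_iter \<beta> ?h ?a ?K T)"
      by (intro Bochner_Integration.integral_cong refl expectation_discounted_path_sum[OF \<beta> c_bounded]) simp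
    finally show ?thesis .
  qed
  moreover have "(\<lambda>T. measure_pmf.expectation Q (value_iter \<beta> ?h ?a ?K T))
      \<longlonglongrightarrow> measure_pmf.expectation Q (discounted_value \<beta> ?h ?a ?K)"
    by (rule expectation_value_iter_tendsto[OF \<beta> c_bounded]) simp
  ultimately show ?thesis
    unfolding L_sf_def by (simp add: limI)
qed

lemma M_sf_eq_L_sf: "M_sf P Q \<beta> g = L_sf P Q (\<lambda>_ _. 1) \<beta> g"
  by (simp add: M_sf_def L_sf_def)

lemma N_sf_eq_D_sf: "N_sf P Q \<beta> g = D_sf P Q (\<lambda>_ b. of_bool b) \<beta> g"
proof -
  have "N_pol P Q \<beta> g = D_pol P Q (\<lambda>_ b. of_bool b) \<beta> g"
    by (simp add: fun_eq_iff N_pol_def D_pol_def)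
  then show ?thesis by (simp add: N_sf_def D_sf_def)
qed

lemma M_sf_ge_1:
  assumes \<beta>: "0 \<le> \<beta>" "\<beta> < 1"
  shows "1 \<le> M_sf P Q \<beta> g"
proof -
  let ?V = "discounted_value \<beta> (\<lambda>_. 1) (\<lambda>x. of_bool (\<not> g x)) (ctrl_kernel P Q g)"
  have "M_sf P Q \<beta> g = measure_pmf.expectation Q ?V"
    unfolding M_sf_eq_L_sf by (rule L_sf_eq_expectation_discounted_value[OF \<beta>, where B=1]) simp
  moreover have "1 \<le> measure_pmf.expectation Q ?V"
  proof (rule measure_pmf.integral_ge_const)
    show "integrable (measure_pmf Q) ?V"
      by (rule integrable_discounted_value[OF \<beta>, where B=1]) simp_all
    show "AE x in measure_pmf Q. 1 \<le> ?V x"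
      by (intro AE_I2 discounted_value_one_ge_1[OF \<beta>]) simp_all
  qed
  ultimately show ?thesis by simp
qed

lemma L_sf_of_bool_cost:
  assumes \<beta>: "0 \<le> \<beta>" "\<beta> < 1"
  shows "\<beta> * L_sf P Q (\<lambda>_ b. of_bool b) \<beta> g = 1 - (1 - \<beta>) * M_sf P Q \<beta> g"
proof -
  let ?a = "\<lambda>x. of_bool (\<not> g x) :: real" and ?K = "ctrl_kernel P Q g"
  let ?V1 = "discounted_value \<beta> (\<lambda>_. 1) ?a ?K" and ?Vg = "discounted_value \<beta> (\<lambda>x. of_bool (g x)) ?a ?K"
  have L_eq: "L_sf P Q (\<lambda>_ b. of_bool b) \<beta> g = measure_pmf.expectation Q ?Vg"
    by (rule L_sf_eq_expectation_discounted_value[OF \<beta>, where B=1]) simp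
  have M_eq: "M_sf P Q \<beta> g = measure_pmf.expectation Q ?V1"
    unfolding M_sf_eq_L_sf by (rule L_sf_eq_expectation_discounted_value[OF \<beta>, where B=1]) simp
  have "integrable (measure_pmf Q) ?V1" and "integrable (measure_pmf Q) ?Vg"
    by (rule integrable_discounted_value[OF \<beta>, where B=1]; simp)+
  then have "(1 - \<beta>) * measure_pmf.expectation Q ?V1 + \<beta> * measure_pmf.expectation Q ?Vg
      = measure_pmf.expectation Q (\<lambda>x. (1 - \<beta>) * ?V1 x + \<beta> * ?Vg x)"
    by simp
  also have "\<dots> = 1"
    by (simp add: discounted_value_hitting_identity[OF \<beta>])
  finally show ?thesis unfolding L_eq M_eq by (simp add: algebra_simps)
qed

lemma D_sf_eq_L_sf_div_M_sf:
  fixes c :: "'x \<Rightarrow> bool \<Rightarrow> real"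
  assumes \<beta>: "0 \<le> \<beta>" "\<beta> < 1" and c_bounded: "\<And>x b. \<bar>c x b\<bar> \<le> B"
  shows "D_sf P Q c \<beta> g = L_sf P Q c \<beta> g / M_sf P Q \<beta> g"
proof -
  let ?h = "\<lambda>x. c x (g x)" and ?a = "\<lambda>x. of_bool (\<not> g x) :: real" and ?K = "ctrl_kernel P Q g"
  let ?V = "discounted_value \<beta> ?h (\<lambda>_. 1) ?K" and ?S = "discounted_value \<beta> ?h ?a ?K"
    and ?Sg = "discounted_value \<beta> (\<lambda>x. of_bool (g x)) ?a ?K"
  define EV where "EV = measure_pmf.expectation Q ?V"
  have S_integrable: "integrable (measure_pmf Q) ?S"
    by (rule integrable_discounted_value[OF \<beta> c_bounded]) simp
  have Sg_integrable: "integrable (measure_pmf Q) ?Sg"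
    by (rule integrable_discounted_value[OF \<beta>, where B=1]) simp_all
  have renewal: "?V x = ?S x + \<beta> * EV * ?Sg x" for x
    unfolding EV_def by (rule policy_value_renewal[OF \<beta>]) (rule c_bounded)
  have "EV = measure_pmf.expectation Q ?V"
    by (simp only: EV_def)
  also have "\<dots> = measure_pmf.expectation Q (\<lambda>x. ?S x + \<beta> * EV * ?Sg x)"
    by (intro Bochner_Integration.integral_cong refl renewal)
  also have "\<dots> = L_sf P Q c \<beta> g + EV * (\<beta> * L_sf P Q (\<lambda>_ b. of_bool b) \<beta> g)"
    using S_integrable Sg_integrable
    by (simp add: L_sf_eq_expectation_discounted_value[OF \<beta> c_bounded]
        L_sf_eq_expectation_discounted_value[OF \<beta>, where B=1])
  finally have "(1 - \<beta>) * EV * M_sf P Q \<beta> g = L_sf P Q c \<beta> g"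
    unfolding L_sf_of_bool_cost[OF \<beta>] by (simp add: algebra_simps)
  moreover have "D_sf P Q c \<beta> g = (1 - \<beta>) * EV"
    unfolding D_sf_def EV_def D_pol_eq_discounted_value[OF \<beta> c_bounded] by simp
  ultimately have "D_sf P Q c \<beta> g * M_sf P Q \<beta> g = L_sf P Q c \<beta> g"
    by simp
  then show ?thesis
    using M_sf_ge_1[OF \<beta>, of P Q g] by (simp add: eq_divide_eq)
qed

theorem theorem4:
  fixes P :: "'x::countable \<Rightarrow> 'x pmf" and Q :: "'x pmf"
    and c :: "'x \<Rightarrow> bool \<Rightarrow> real" and \<beta> :: real and g :: "'x \<Rightarrow> bool"
  assumes "0 < \<beta>" and "\<beta> < 1"
    and "\<exists>B. \<forall>x a. \<bar>c x a\<bar> \<le> B"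
  shows "D_sf P Q c \<beta> g = L_sf P Q c \<beta> g / M_sf P Q \<beta> g
       \<and> N_sf P Q \<beta> g = 1 / (\<beta> * M_sf P Q \<beta> g) - (1 - \<beta>) / \<beta>"
proof
  have \<beta>: "0 \<le> \<beta>" "\<beta> < 1" using assms(1,2) by simp_all
  obtain B where c_bounded: "\<And>x b. \<bar>c x b\<bar> \<le> B" using assms(3) by blast
  show "D_sf P Q c \<beta> g = L_sf P Q c \<beta> g / M_sf P Q \<beta> g"
    by (rule D_sf_eq_L_sf_div_M_sf[OF \<beta> c_bounded])
  have "N_sf P Q \<beta> g = L_sf P Q (\<lambda>_ b. of_bool b) \<beta> g / M_sf P Q \<beta> g"
    unfolding N_sf_eq_D_sf by (rule D_sf_eq_L_sf_div_M_sf[OF \<beta>, where B=1]) simp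
  then show "N_sf P Q \<beta> g = 1 / (\<beta> * M_sf P Q \<beta> g) - (1 - \<beta>) / \<beta>"
    using L_sf_of_bool_cost[OF \<beta>, of P Q g] M_sf_ge_1[OF \<beta>, of P Q g] assms(1)
    by (simp add: field_simps)
qed

end
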